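(* For nonnegative integers $m<n$, let $f(m,n)$ denote the number of relatively prime subsets of $\{m+1,m+2,\ldots,n\}$. Then \[ f(m,n)=\sum_{d=1}^{n}\mu(d)\left(2^{[n/d]-[m/d]}-1\right) \] and \[ 0\le 2^{n-m}-2^{[n/2]-[m/2]}-f(m,n)\le 2n\,2^{[(n-m)/3]}. \]
   Context: A nonempty set $A$ of integers is called relatively prime if $\gcd(A)=1$; in particular the empty set is not relatively prime. $\mu$ denotes the Möbius function. For a real number $x$, $[x]$ denotes the greatest integer not exceeding $x$. *)

theory Defs
  imports Complex_Main "HOL-Computational_Algebra.Squarefree"
begin

definition moebius :: "nat \<Rightarrow> int" where
  "moebius n = (if squarefree n then (- 1) ^ card (prime_factors n) else 0)"

definition relatively_prime :: "int set \<Rightarrow> bool" where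
  "relatively_prime A \<longleftrightarrow> A \<noteq> {} \<and> Gcd A = 1"

definition rel_prime_count :: "nat \<Rightarrow> nat \<Rightarrow> nat" where
  "rel_prime_count m n = card {A. A \<subseteq> {int m + 1..int n} \<and> relatively_prime A}"

end

(* Classify the nonempty subsets A of {m+1..n} by their gcd.  Exactly 2^([n/d] - [m/d]) - 1 of them
   consist of multiples of d, so summing the divisor sum of the Moebius function at gcd A over all A
   in two ways gives the formula.  For the bounds, a set that is neither relatively prime nor
   contained in the even numbers is a nonempty set of multiples of some d with 3 \<le> d \<le> n, and
   [n/d] - [m/d] \<le> [(n - m)/3] + 1 for each such d. *)
theory Submission
  imports Defs
begin

text \<open>A squarefree number is the product of its distinct prime factors, so taking the product
  of a set of primes inverts \<open>prime_factors\<close>. This turns a divisor sum of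
  \<open>moebius\<close> into a sum over sets of primes.\<close>

lemma bij_betw_prime_factors_squarefree_divisors:
  fixes n :: nat
  assumes "n > 0"
  shows "bij_betw prime_factors {d. d dvd n \<and> squarefree d} (Pow (prime_factors n))"
proof (rule bij_betw_byWitness[where f' = "\<lambda>X. \<Prod>X"])
  have prime_factors_Prod: "prime_factors (\<Prod>X) = X" if "X \<subseteq> prime_factors n" for X
  proof -
    have "finite X" using that finite_subset by blast
    have "\<And>p. p \<in> X \<Longrightarrow> prime p" using that by (auto simp: prime_factors_dvd)
    then have "0 \<notin> id ` X" by (metis id_apply image_iff not_prime_0)
    with \<open>finite X\<close> have "prime_factors (prod id X) = \<Union> ((prime_factors \<circ> id) ` X)"
      by (intro prime_factors_prod) auto
    also have "\<dots> = X"
      using \<open>\<And>p. p \<in> X \<Longrightarrow> prime p\<close> by (auto simp: prime_prime_factors)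
    finally show ?thesis by (simp add: prod.cong[of X X id "\<lambda>x. x"])
  qed
  then show "\<forall>X\<in>Pow (prime_factors n). prime_factors (\<Prod>X) = X" by blast
  show "\<forall>d\<in>{d. d dvd n \<and> squarefree d}. \<Prod>(prime_factors d) = d"
  proof
    fix d assume "d \<in> {d. d dvd n \<and> squarefree d}"
    then have d: "squarefree d" "d \<noteq> 0" using assms by auto
    \<comment> \<open>Squarefreeness makes every multiplicity here equal to 1.\<close>
    then have "(\<Prod>p\<in>prime_factors d. p) = (\<Prod>p\<in>prime_factors d. p ^ multiplicity p d)"
      by (intro prod.cong) (auto simp: squarefree_factorial_semiring')
    then show "\<Prod>(prime_factors d) = d"
      using d(2) by (simp add: prod_prime_factors)
  qed
  show "prime_factors ` {d. d dvd n \<and> squarefree d} \<subseteq> Pow (prime_factors n)"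
    using dvd_prime_factors[of n] assms by auto
  show "(\<lambda>X. \<Prod>X) ` Pow (prime_factors n) \<subseteq> {d. d dvd n \<and> squarefree d}"
  proof safe
    fix X assume X: "X \<subseteq> prime_factors n"
    have "\<Prod>X dvd \<Prod>(prime_factors n)"
      using X by (intro prod_dvd_prod_subset) auto
    \<comment> \<open>The radical of \<open>n\<close> divides \<open>n\<close>, since each of its
      primes occurs with multiplicity at least 1.\<close>
    also have "\<dots> dvd (\<Prod>p\<in>prime_factors n. p ^ multiplicity p n)"
      by (intro prod_dvd_prod) (auto simp: prime_factors_multiplicity intro!: dvd_power)
    also have "\<dots> = n" using assms by (simp add: prod_prime_factors)
    finally show "\<Prod>X dvd n" .
    have "\<And>p. p \<in> X \<Longrightarrow> prime p" using X by (auto simp: prime_factors_dvd)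
    then show "squarefree (\<Prod>X)"
      by (intro squarefree_prod_coprime) (auto intro: primes_coprime squarefree_prime)
  qed
qed

lemma sum_moebius_divisors:
  assumes "n > 0"
  shows "(\<Sum>d | d dvd n. moebius d) = (if n = 1 then 1 else 0)"
proof -
  let ?P = "prime_factors n"
  have "(\<Sum>d | d dvd n. moebius d)
      = (\<Sum>d | d dvd n \<and> squarefree d. (- 1) ^ card (prime_factors d))"
    using assms by (intro sum.mono_neutral_cong_right) (auto simp: moebius_def)
  also have "\<dots> = (\<Sum>X\<in>Pow ?P. (- 1) ^ card X)"
    by (rule sum.reindex_bij_betw[OF bij_betw_prime_factors_squarefree_divisors[OF assms]])
  \<comment> \<open>Expanding the product picks -1 for the primes in \<open>X\<close> and 1 for the
    others. The product vanishes unless it is empty, that is, unless \<open>n = 1\<close>.\<close>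
  also have "\<dots> = (\<Prod>p\<in>?P. - 1 + 1)"
    by (subst prod_add) auto
  also have "\<dots> = (if n = 1 then 1 else 0)"
    using assms by (auto simp: prime_factorization_empty_iff card_eq_0_iff power_0_left)
  finally show ?thesis .
qed

definition multiples_in :: "nat \<Rightarrow> nat \<Rightarrow> nat \<Rightarrow> int set" where
  "multiples_in m n d = {x \<in> {int m + 1..int n}. int d dvd x}"

lemma finite_multiples_in [simp]: "finite (multiples_in m n d)"
  unfolding multiples_in_def by (rule finite_subset[of _ "{int m + 1..int n}"]) auto

text \<open>The multiples are the numbers \<open>d * k\<close> with \<open>k\<close> in the
  half-open interval from \<open>m div d\<close> (excluded) to \<open>n div d\<close>
  (included).\<close>

lemma card_multiples_in:
  assumes "d > 0"
  shows "card (multiples_in m n d) = n div d - m div d"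
proof -
  have "multiples_in m n d = (\<lambda>k. int (d * k)) ` {m div d<..n div d}"
  proof (intro equalityI subsetI)
    fix x assume x: "x \<in> multiples_in m n d"
    then have "x = int (nat x)" "d dvd nat x"
      by (auto simp: multiples_in_def nat_dvd_iff simp flip: int_dvd_int_iff)
    then obtain k where k: "x = int (d * k)" by (metis dvdE)
    have "int m + 1 \<le> int (d * k)" "int (d * k) \<le> int n"
      using x unfolding multiples_in_def k by simp_all
    then have "m < d * k" "d * k \<le> n" by linarith+
    then have "k \<in> {m div d<..n div d}"
      using assms by (auto simp: div_less_iff_less_mult less_eq_div_iff_mult_less_eq mult.commute)
    with k show "x \<in> (\<lambda>k. int (d * k)) ` {m div d<..n div d}" by blast
  next
    fix x assume "x \<in> (\<lambda>k. int (d * k)) ` {m div d<..n div d}"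
    then obtain k where k: "x = int (d * k)" "k \<in> {m div d<..n div d}"
      by (rule imageE)
    then have "m < d * k" "d * k \<le> n"
      using assms by (auto simp: div_less_iff_less_mult less_eq_div_iff_mult_less_eq mult.commute)
    then show "x \<in> multiples_in m n d"
      unfolding multiples_in_def k(1) by (auto simp flip: of_nat_mult)
  qed
  then show ?thesis
    using assms by (simp add: card_image inj_on_def)
qed

lemma card_nonempty_subsets_multiples_in:
  assumes "d > 0"
  shows "int (card (Pow (multiples_in m n d) - {{}})) = 2 ^ (n div d - m div d) - 1"
  using assms by (simp add: card_Diff_singleton card_Pow card_multiples_in of_nat_diff)

text \<open>Translates containment into divisibility of the gcd. The empty set fits in, as its
  \<open>Gcd\<close> is 0, which every \<open>d\<close> divides.\<close>

lemma subset_multiples_in_iff: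
  "A \<subseteq> multiples_in m n d \<longleftrightarrow> A \<subseteq> {int m + 1..int n} \<and> int d dvd Gcd A"
  by (auto simp: multiples_in_def dvd_Gcd_iff)

text \<open>The gcd divides some member of \<open>A\<close>, and all members are positive because
  \<open>m\<close> is a natural number.\<close>

lemma Gcd_bounds:
  assumes "A \<subseteq> {int m + 1..int n}" "A \<noteq> {}"
  shows "Gcd A > 0" "Gcd A \<le> int n"
proof -
  obtain x where x: "x \<in> A" using assms by auto
  with assms have "0 < x" "x \<le> int n" by auto
  moreover have "Gcd A dvd x" using x by (rule Gcd_dvd)
  ultimately have "Gcd A \<noteq> 0" "Gcd A \<le> x" by (auto intro: zdvd_imp_le simp del: Gcd_0_iff)
  moreover have "Gcd A \<ge> 0" by simp
  ultimately show "Gcd A > 0" "Gcd A \<le> int n" using \<open>x \<le> int n\<close> by linarith+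
qed

text \<open>Double counting of the pairs \<open>(d, A)\<close> with \<open>d\<close> dividing
  \<open>Gcd A\<close>, each weighted by \<open>moebius d\<close>.\<close>

lemma rel_prime_count_eq_sum:
  "int (rel_prime_count m n) = (\<Sum>d=1..n. moebius d * (2 ^ (n div d - m div d) - 1))"
proof -
  define F where "F = Pow {int m + 1..int n} - {{}}"
  have "finite F" by (simp add: F_def)
  \<comment> \<open>Since \<open>Gcd A\<close> lies between 1 and \<open>n\<close>, the range of
    \<open>d\<close> contains all its divisors, and the full divisor sum appears.\<close>
  have moebius_Gcd: "(\<Sum>d=1..n. if int d dvd Gcd A then moebius d else 0) = (if Gcd A = 1 then 1 else 0)"
    if "A \<in> F" for A
  proof -
    have A: "Gcd A > 0" "Gcd A \<le> int n"
      using that Gcd_bounds[of A m n] by (auto simp: F_def)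
    define g where "g = nat (Gcd A)"
    have g: "Gcd A = int g" "g > 0" "g \<le> n" using A by (auto simp: g_def)
    have "(\<Sum>d=1..n. if int d dvd Gcd A then moebius d else 0)
        = (\<Sum>d\<in>{d \<in> {1..n}. d dvd g}. moebius d)"
      by (simp add: g(1) sum.inter_filter del: mem_Collect_eq One_nat_def atLeastAtMost_iff)
    also have "{d \<in> {1..n}. d dvd g} = {d. d dvd g}"
      using g by (auto dest: dvd_imp_le intro: Suc_leI dvd_pos_nat)
    finally show ?thesis using g by (simp add: sum_moebius_divisors)
  qed
  have "(\<Sum>d=1..n. moebius d * (2 ^ (n div d - m div d) - 1))
      = (\<Sum>d=1..n. moebius d * int (card (Pow (multiples_in m n d) - {{}})))"
    by (intro sum.cong refl, subst card_nonempty_subsets_multiples_in) auto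
  also have "\<dots> = (\<Sum>d=1..n. \<Sum>A\<in>F. if int d dvd Gcd A then moebius d else 0)"
  proof (intro sum.cong refl)
    fix d
    have "Pow (multiples_in m n d) - {{}} = {A \<in> F. int d dvd Gcd A}"
      unfolding F_def Pow_def subset_multiples_in_iff by blast
    then show "moebius d * int (card (Pow (multiples_in m n d) - {{}}))
        = (\<Sum>A\<in>F. if int d dvd Gcd A then moebius d else 0)"
      using \<open>finite F\<close> by (simp add: mult.commute flip: sum.inter_filter)
  qed
  also have "\<dots> = (\<Sum>A\<in>F. \<Sum>d=1..n. if int d dvd Gcd A then moebius d else 0)"
    by (rule sum.swap)
  also have "\<dots> = (\<Sum>A\<in>F. if Gcd A = 1 then 1 else 0)"
    by (intro sum.cong moebius_Gcd refl)
  also have "\<dots> = int (card {A \<in> F. Gcd A = 1})"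
    using \<open>finite F\<close> by (simp flip: sum.inter_filter)
  also have "{A \<in> F. Gcd A = 1} = {A. A \<subseteq> {int m + 1..int n} \<and> relatively_prime A}"
    by (auto simp: F_def relatively_prime_def)
  finally show ?thesis by (simp add: rel_prime_count_def)
qed

text \<open>Adding \<open>m\<close> to \<open>n - m\<close> produces a carry of at most 1 from the
  two remainders. That carry is the source of the factor 2 in the final upper bound.\<close>

lemma div_diff_le_third:
  fixes m n d :: nat
  assumes "m \<le> n" "d \<ge> 3"
  shows "n div d - m div d \<le> (n - m) div 3 + 1"
proof -
  have "n = (n - m) + m" using assms by simp
  then have "n div d = (n - m) div d + m div d + ((n - m) mod d + m mod d) div d"
    by (metis div_add1_eq)
  moreover have "((n - m) mod d + m mod d) div d < 2"
  proof (rule less_mult_imp_div_less)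
    have "(n - m) mod d < d" "m mod d < d" using assms by auto
    then show "(n - m) mod d + m mod d < 2 * d" by linarith
  qed
  moreover have "(n - m) div d \<le> (n - m) div 3" using assms by (intro div_le_mono2) auto
  ultimately show ?thesis by linarith
qed

text \<open>\<open>D\<close> is the number of subsets that are neither relatively prime nor made of
  even numbers only, hence nonnegative. The upper bound covers these subsets by the possible values
  of the gcd.\<close>

lemma rel_prime_count_bounds:
  assumes "m < n"
  defines "D \<equiv> (2::int) ^ (n - m) - 2 ^ (n div 2 - m div 2) - int (rel_prime_count m n)"
  shows "0 \<le> D" "D \<le> 2 * int n * 2 ^ ((n - m) div 3)"
proof -
  let ?I = "{int m + 1..int n}"
  let ?E = "multiples_in m n 2"
  define R where "R = {A. A \<subseteq> ?I \<and> relatively_prime A}"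
  have E: "Pow ?E \<subseteq> Pow ?I" by (auto simp: multiples_in_def)
  \<comment> \<open>A set of even numbers has a gcd divisible by 2, so it cannot be relatively
    prime.\<close>
  have R: "R \<subseteq> Pow ?I - Pow ?E"
    by (auto simp: R_def relatively_prime_def subset_multiples_in_iff)
  have "finite R" using R by (rule finite_subset) simp
  have "card (Pow ?I - Pow ?E - R) = card (Pow ?I) - card (Pow ?E) - card R"
    using E R \<open>finite R\<close> by (simp add: card_Diff_subset)
  \<comment> \<open>These inequalities ensure that the subtractions on \<open>nat\<close> do not
    truncate, so the identity carries over to the integers.\<close>
  moreover have "card R \<le> card (Pow ?I - Pow ?E)" using R by (intro card_mono) auto
  then have "card R \<le> card (Pow ?I) - card (Pow ?E)" using E by (simp add: card_Diff_subset)
  moreover have "card (Pow ?E) \<le> card (Pow ?I)" using E by (intro card_mono) auto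
  ultimately have "int (card (Pow ?I - Pow ?E - R))
      = int (card (Pow ?I)) - int (card (Pow ?E)) - int (card R)" by linarith
  also have "\<dots> = D"
    using assms by (simp add: D_def R_def rel_prime_count_def card_Pow card_multiples_in nat_diff_distrib)
  finally have D: "D = int (card (Pow ?I - Pow ?E - R))" ..
  then show "0 \<le> D" by simp
  have "Pow ?I - Pow ?E - R \<subseteq> (\<Union>d\<in>{3..n}. Pow (multiples_in m n d) - {{}})"
  proof
    fix A assume A: "A \<in> Pow ?I - Pow ?E - R"
    \<comment> \<open>The empty set is already removed as a member of \<open>Pow ?E\<close>. The gcd
      is then positive and differs from 1 and 2, so it is at least 3.\<close>
    then have "A \<subseteq> ?I" "A \<noteq> {}" by auto
    note bounds = Gcd_bounds[OF this]
    have "Gcd A \<noteq> 1" using A \<open>A \<noteq> {}\<close> by (auto simp: R_def relatively_prime_def)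
    moreover have "Gcd A \<noteq> 2"
      using A by (auto simp: subset_multiples_in_iff)
    ultimately have "nat (Gcd A) \<in> {3..n}" using bounds by auto
    moreover have "A \<in> Pow (multiples_in m n (nat (Gcd A))) - {{}}"
      using \<open>A \<subseteq> ?I\<close> \<open>A \<noteq> {}\<close> by (simp add: subset_multiples_in_iff)
    ultimately show "A \<in> (\<Union>d\<in>{3..n}. Pow (multiples_in m n d) - {{}})" by blast
  qed
  then have "card (Pow ?I - Pow ?E - R) \<le> card (\<Union>d\<in>{3..n}. Pow (multiples_in m n d) - {{}})"
    by (intro card_mono) auto
  also have "\<dots> \<le> (\<Sum>d\<in>{3..n}. card (Pow (multiples_in m n d) - {{}}))"
    by (rule card_UN_le) simp
  finally have "D \<le> (\<Sum>d\<in>{3..n}. int (card (Pow (multiples_in m n d) - {{}})))"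
    unfolding D by (simp only: of_nat_le_iff flip: of_nat_sum)
  also have "\<dots> \<le> (\<Sum>d\<in>{3..n}. 2 * 2 ^ ((n - m) div 3))"
  proof (rule sum_mono)
    fix d assume d: "d \<in> {3..n}"
    then have "(2::int) ^ (n div d - m div d) \<le> 2 ^ ((n - m) div 3 + 1)"
      using assms by (intro power_increasing div_diff_le_third) auto
    then show "int (card (Pow (multiples_in m n d) - {{}})) \<le> 2 * 2 ^ ((n - m) div 3)"
      using d by (subst card_nonempty_subsets_multiples_in) auto
  qed
  \<comment> \<open>The index set has at most \<open>n\<close> elements, and the summand is
    constant.\<close>
  also have "\<dots> \<le> 2 * int n * 2 ^ ((n - m) div 3)"
    by (simp add: mult_right_mono)
  finally show "D \<le> 2 * int n * 2 ^ ((n - m) div 3)" .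
qed

theorem theorem1:
  fixes m n :: nat
  assumes "m < n"
  shows "int (rel_prime_count m n) =
           (\<Sum>d=1..n. moebius d * (2 ^ nat (\<lfloor>real n / real d\<rfloor> - \<lfloor>real m / real d\<rfloor>) - 1)) \<and>
         0 \<le> (2::int) ^ (n - m) - 2 ^ nat (\<lfloor>real n / 2\<rfloor> - \<lfloor>real m / 2\<rfloor>) - int (rel_prime_count m n) \<and>
         (2::int) ^ (n - m) - 2 ^ nat (\<lfloor>real n / 2\<rfloor> - \<lfloor>real m / 2\<rfloor>) - int (rel_prime_count m n)
           \<le> 2 * int n * 2 ^ nat \<lfloor>real (n - m) / 3\<rfloor>"
proof -
  \<comment> \<open>The floor of a quotient of naturals is \<open>div\<close>, and
    \<open>nat\<close> truncates a negative difference just as subtraction on \<open>nat\<close>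
    does.\<close>
  have floor_div: "nat (\<lfloor>real n / real d\<rfloor> - \<lfloor>real m / real d\<rfloor>) = n div d - m div d" for d
    by (simp add: floor_divide_of_nat_eq nat_diff_distrib')
  have "nat \<lfloor>real (n - m) / 3\<rfloor> = (n - m) div 3"
    using floor_divide_of_nat_eq[of "n - m" 3, where ?'a = real] by simp
  then show ?thesis
    using rel_prime_count_eq_sum[of m n] rel_prime_count_bounds[OF assms] floor_div floor_div[of 2]
    by simp
qed

end
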